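(* Let $m\ge1$, let $\vec n=(n_1,\ldots,n_m)$ be a multi-index of nonnegative integers, and let $\alpha_1,\ldots,\alpha_m,\beta\in\mathbb{C}$ with $\alpha_j,\beta,\alpha_j+\beta\notin\{-1,-2,\ldots\}$ for $j=1,\ldots,m$. Put $s_j=n_1+\cdots+n_j$. Then the Jacobi-Piñeiro polynomial $P_{\vec n}^{(\vec\alpha,\beta)}$ has the hypergeometric representations $$P_{\vec n}^{(\vec\alpha,\beta)}(t)=\frac{\prod_{j=1}^m(\alpha_j+1)_{n_j}}{\vec n!}\sum_{k_1=0}^{n_1}\cdots\sum_{k_m=0}^{n_m}\frac{(\alpha_1+\beta+n_1+1)_{|\vec k|}}{(\alpha_1+1)_{|\vec k|}}\left[\prod_{i=1}^{m-1}\frac{(\alpha_i+n_i+1)_{K_i}\,(\alpha_{i+1}+s_{i+1}+\beta+1)_{K_i}}{(\alpha_{i+1}+1)_{K_i}\,(\alpha_i+s_i+\beta+1)_{K_i}}\right]\prod_{j=1}^m\frac{(-n_j)_{k_j}\,t^{k_j}}{k_j!},$$ where $|\vec k|=k_1+\cdots+k_m$ and $K_i=|\vec k|-k_1-\cdots-k_i=k_{i+1}+\cdots+k_m$, and, for $|t|<1$, $$P_{\vec n}^{(\vec\alpha,\beta)}(t)=\frac{\prod_{j=1}^m(\alpha_j+1)_{n_j}}{\vec n!}\,(1-t)^{-\beta}\;{}_{m+1}F_m\!\left(\left.{\alpha_1+n_1+1,\ldots,\alpha_m+n_m+1,\,-\beta-|\vec n|\atop \alpha_1+1,\ldots,\a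lpha_m+1}\right|t\right).$$
   Context: Notation: $|\vec n|=n_1+\cdots+n_m$, $\vec n!=\prod_{j=1}^m n_j!$, $(x)_k=x(x+1)\cdots(x+k-1)$ is the Pochhammer symbol, ${}_pF_q$ is the generalized hypergeometric series, and powers are principal. The Jacobi-Piñeiro polynomial is defined by the Rodrigues formula $$P_{\vec n}^{(\vec\alpha,\beta)}(t)=\frac{1}{\vec n!}(1-t)^{-\beta}\prod_{j=1}^m\left(t^{-\alpha_j}\frac{d^{n_j}}{dt^{n_j}}t^{n_j+\alpha_j}\right)(1-t)^{|\vec n|+\beta},$$ where each factor $t^{-\alpha_j}\frac{d^{n_j}}{dt^{n_j}}t^{n_j+\alpha_j}$ is the operator that multiplies by $t^{n_j+\alpha_j}$, differentiates $n_j$ times, then multiplies by $t^{-\alpha_j}$; the product is a composition of operators (the order is irrelevant) applied to $(1-t)^{|\vec n|+\beta}$. The formula is read for $t\in(0,1)$, where it defines a polynomial in $t$, which is then considered for all complex $t$. *)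

theory Defs
  imports "HOL-Analysis.Analysis"
begin

definition multi_size :: "nat \<Rightarrow> (nat \<Rightarrow> nat) \<Rightarrow> nat" where
  "multi_size m n = (\<Sum>j=1..m. n j)"

definition multi_fact :: "nat \<Rightarrow> (nat \<Rightarrow> nat) \<Rightarrow> nat" where
  "multi_fact m n = (\<Prod>j=1..m. fact (n j))"

(* The derivative is the one with respect to a real variable, for complex-valued functions.
   Only points of (0,1) are ever relevant; the derivatives there depend only on the
   values on (0,1). *)
definition rodrigues_op :: "complex \<Rightarrow> nat \<Rightarrow> (real \<Rightarrow> complex) \<Rightarrow> (real \<Rightarrow> complex)" where
  "rodrigues_op a n f =
     (\<lambda>t. of_real t powr (- a) *
        ((\<lambda>g x. vector_derivative g (at x)) ^^ n)
          (\<lambda>x. of_real x powr (of_nat n + a) * f x) t)"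

(* The multi-index and the parameters are indexed by 1, ..., m. *)
definition rodrigues ::
  "nat \<Rightarrow> (nat \<Rightarrow> nat) \<Rightarrow> (nat \<Rightarrow> complex) \<Rightarrow> complex \<Rightarrow> real \<Rightarrow> complex" where
  "rodrigues m n \<alpha> \<beta> t =
     1 / of_nat (multi_fact m n) * (1 - of_real t) powr (- \<beta>) *
     foldr (\<lambda>j. rodrigues_op (\<alpha> j) (n j)) [1..<Suc m]
       (\<lambda>x. (1 - of_real x) powr (of_nat (multi_size m n) + \<beta>)) t"

(* Two polynomials that agree on (0,1) are equal, so the description is unique. *)
definition jacobi_pineiro ::
  "nat \<Rightarrow> (nat \<Rightarrow> nat) \<Rightarrow> (nat \<Rightarrow> complex) \<Rightarrow> complex \<Rightarrow> complex poly" where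
  "jacobi_pineiro m n \<alpha> \<beta> =
     (THE p. \<forall>t\<in>{0<..<1}. poly p (of_real t) = rodrigues m n \<alpha> \<beta> t)"

definition hypergeometric :: "complex list \<Rightarrow> complex list \<Rightarrow> complex \<Rightarrow> complex" where
  "hypergeometric as bs z = eval_fps (fps_hypergeo as bs 1) z"

end

theory Submission
  imports Defs
begin

text \<open>
  On \<open>(0,1)\<close> the operator \<open>t powr (-a) (d/dt)^n t powr (n + a)\<close> maps \<open>t^l\<close> to
  \<open>pochhammer (a + 1 + l) n * t^l\<close>. On convergent power series it is therefore the purely formal
  operator \<open>fps_jacobi_op\<close>, which rescales the coefficients. That is the content of
  \<open>rodrigues_op_eval_fps\<close>, whose proof is the only one to handle derivatives with respect to a real
  variable; everything else is an identity between formal power series, evaluated in the unit disc.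

  Let \<open>F\<close> be the series obtained from \<open>(1 - X) powr (\<beta> + N)\<close>, with \<open>N = n 1 + ... + n m\<close>, by
  applying all \<open>m\<close> operators. It is computed in two ways. Rescaling the binomial coefficients
  directly, with \<open>(a+1+l)_n = (a+1)_n (a+n+1)_l / (a+1)_l\<close>, exhibits \<open>F\<close> as a hypergeometric
  series (\<open>foldr_fps_jacobi_op_eq_hypergeo\<close>). Alternatively the operators are applied one at a
  time. The classical Rodrigues formula for Jacobi polynomials
  (\<open>fps_jacobi_op_one_minus_powr\<close>) says that one operator with parameters \<open>a\<close>, \<open>n\<close> turns
  \<open>(1 - X) powr (g + n)\<close> into \<open>(1 - X) powr g\<close> times a polynomial of degree at most \<open>n\<close>. A factor
  \<open>X^K\<close> left over from the previous operators merely shifts \<open>a\<close> to \<open>a + K\<close>. Iterating gives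
  \<open>F = (1 - X) powr \<beta>\<close> times an \<open>m\<close>-fold sum
  (\<open>foldr_fps_jacobi_op_one_minus_powr\<close>). The coefficients of this sum are products of coefficients
  of Jacobi polynomials with shifted parameters; splitting every shifted Pochhammer symbol
  as a quotient of two unshifted ones brings them into the required form
  (\<open>jacobi_pineiro_weight_conv_pochhammer\<close>).

  The second computation shows that \<open>(1 - t) powr (-\<beta>) * F(t)\<close> agrees with a polynomial
  throughout the unit disc. Up to the factor \<open>1 / ((n 1)! ... (n m)!)\<close> this is the Jacobi-Pineiro
  polynomial, so that comparing the two computations of \<open>F\<close> yields both representations.
\<close>

unbundle no vec_syntax and fps_syntax

section \<open>The formal counterpart of a Rodrigues factor\<close>

text \<open>
  The action of \<open>t powr (-a) (d/dt)^n t powr (n + a)\<close> on power series, read off from its action on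
  monomials.
\<close>

definition fps_jacobi_op :: "'a \<Rightarrow> nat \<Rightarrow> 'a::comm_ring_1 fps \<Rightarrow> 'a fps" where
  "fps_jacobi_op a n F = Abs_fps (\<lambda>l. pochhammer (a + 1 + of_nat l) n * F $ l)"

lemma fps_jacobi_op_nth [simp]:
  "fps_jacobi_op a n F $ l = pochhammer (a + 1 + of_nat l) n * F $ l"
  by (simp add: fps_jacobi_op_def)

lemma fps_jacobi_op_0 [simp]: "fps_jacobi_op a 0 F = F"
  by (simp add: fps_eq_iff)

text \<open>
  One derivative can be split off because \<open>d/dt (t powr (a+1) G) = t powr a ((a+1) G + t G')\<close>. This
  recursion drives both inductions on \<open>n\<close> below, the formal one for the Rodrigues formula and the
  analytic one for the derivatives.
\<close>

lemma fps_jacobi_op_Suc: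
  "fps_jacobi_op a (Suc n) F =
     fps_const (a + 1) * fps_jacobi_op (a + 1) n F + fps_X * fps_deriv (fps_jacobi_op (a + 1) n F)"
proof (rule fps_ext)
  fix l
  show "fps_jacobi_op a (Suc n) F $ l = (fps_const (a + 1) * fps_jacobi_op (a + 1) n F
     + fps_X * fps_deriv (fps_jacobi_op (a + 1) n F)) $ l"
    by (cases l) (simp_all add: pochhammer_rec algebra_simps)
qed

lemma fps_jacobi_op_sum:
  "fps_jacobi_op a n (\<Sum>k\<in>A. f k) = (\<Sum>k\<in>A. fps_jacobi_op a n (f k))"
  by (simp add: fps_eq_iff fps_sum_nth sum_distrib_left)

lemma fps_jacobi_op_const_mult:
  "fps_jacobi_op a n (fps_const c * F) = fps_const c * fps_jacobi_op a n F"
  by (simp add: fps_eq_iff mult_ac)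

text \<open>
  A factor \<open>X^K\<close> passes through the operator because only the exponent \<open>a + l\<close> of a monomial
  \<open>t powr (a + l)\<close> matters.
\<close>

lemma fps_jacobi_op_X_power:
  "fps_jacobi_op a n (fps_X ^ K * F) = fps_X ^ K * fps_jacobi_op (a + of_nat K) n F"
  by (auto simp add: fps_eq_iff fps_X_power_mult_nth of_nat_diff add_ac)

text \<open>
  The binomial series of \<open>(1 - X) powr c\<close>.
\<close>

definition fps_one_minus_powr :: "'a \<Rightarrow> 'a::field_char_0 fps" where
  "fps_one_minus_powr c = Abs_fps (\<lambda>l. pochhammer (- c) l / fact l)"

lemma fps_one_minus_powr_nth [simp]: "fps_one_minus_powr c $ l = pochhammer (- c) l / fact l"
  by (simp add: fps_one_minus_powr_def)

lemma fps_one_minus_powr_add_1: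
  "fps_one_minus_powr (c + 1) = (1 - fps_X) * fps_one_minus_powr c"
proof (rule fps_ext)
  fix l
  show "fps_one_minus_powr (c + 1) $ l = ((1 - fps_X) * fps_one_minus_powr c) $ l"
  proof (cases l)
    case (Suc k)
    define p u v :: 'a where "p = pochhammer (- c) k" and "u = of_nat (Suc k)" and "v = fact k"
    have nz: "u \<noteq> 0" "v \<noteq> 0"
      by (simp_all add: u_def v_def del: of_nat_Suc)
    have "pochhammer (- (c + 1)) (Suc k) = - (c + 1) * p"
      by (simp add: pochhammer_rec p_def)
    moreover have "pochhammer (- c) (Suc k) = (- c + (u - 1)) * p"
      by (simp add: pochhammer_rec' p_def u_def)
    moreover have "- (c + 1) * p / (u * v) = (- c + (u - 1)) * p / (u * v) - p / v"
      using nz by (simp add: field_simps)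
    ultimately have "pochhammer (- (c + 1)) (Suc k) / (u * v) = pochhammer (- c) (Suc k) / (u * v) - p / v"
      by (simp only:)
    moreover have "fact (Suc k) = u * v"
      by (simp add: u_def v_def)
    ultimately show ?thesis
      by (simp add: Suc left_diff_distrib p_def v_def del: fact_Suc)
  qed (simp add: left_diff_distrib)
qed

lemma fps_deriv_one_minus_powr:
  "fps_deriv (fps_one_minus_powr (c + 1)) = fps_const (- (c + 1)) * fps_one_minus_powr c"
proof (rule fps_ext)
  fix k
  define p u v :: 'a where "p = pochhammer (- c) k" and "u = of_nat (Suc k)" and "v = fact k"
  have nz: "u \<noteq> 0" "v \<noteq> 0"
    by (simp_all add: u_def v_def del: of_nat_Suc)
  have "pochhammer (- (c + 1)) (Suc k) = - (c + 1) * p"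
    by (simp add: pochhammer_rec p_def)
  moreover have "u * (- (c + 1) * p / (u * v)) = - (c + 1) * (p / v)"
    using nz by (simp add: field_simps)
  moreover have "fact (Suc k) = u * v"
    by (simp add: u_def v_def)
  ultimately show "fps_deriv (fps_one_minus_powr (c + 1)) $ k
      = (fps_const (- (c + 1)) * fps_one_minus_powr c) $ k"
    by (simp only: fps_deriv_nth fps_one_minus_powr_nth fps_mult_left_const_nth p_def u_def v_def Suc_eq_plus1)
qed

section \<open>The Rodrigues formula for Jacobi polynomials\<close>

text \<open>
  The coefficients of \<open>n! P_n(1 - 2t)\<close>, where \<open>P_n\<close> is the Jacobi polynomial with parameters \<open>a\<close>
  and \<open>g\<close>, that is, of \<open>(a+1)_n 2F1(-n, a+g+n+1; a+1; t)\<close>. They are written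
  without quotients to keep their meaning when \<open>a\<close> is a negative integer.
\<close>

definition jacobi_coeff :: "'a \<Rightarrow> 'a \<Rightarrow> nat \<Rightarrow> nat \<Rightarrow> 'a::field_char_0" where
  "jacobi_coeff a g n k = (-1) ^ k * of_nat (n choose k) *
     pochhammer (a + g + of_nat n + 1) k * pochhammer (a + of_nat k + 1) (n - k)"

lemma jacobi_coeff_eq_0: "n < k \<Longrightarrow> jacobi_coeff a g n k = 0"
  by (simp add: jacobi_coeff_def)

text \<open>
  All Pochhammer symbols that occur are multiples of two common ones, \<open>P\<close> and \<open>R\<close>. What remains
  after cancelling them follows from Pascal's rule and
  \<open>(k+1) binom(n, k+1) = (n-k) binom(n, k)\<close>.
\<close>

lemma jacobi_coeff_Suc:
  "jacobi_coeff a g (Suc n) (Suc k) =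
     (a + 2 + of_nat k) * jacobi_coeff (a + 1) (g + 1) n (Suc k)
     - (a + g + 2 + of_nat k) * jacobi_coeff (a + 1) (g + 1) n k"
proof -
  consider "k < n" | "k = n" | "n < k" by linarith
  then show ?thesis
  proof cases
    case 1
    then obtain d where d: "n = k + 1 + d" using less_iff_Suc_add by auto
    define s where "s = a + g + 2 + of_nat n"
    define P where "P = pochhammer (s + 1) k"
    define R where "R = pochhammer (a + of_nat k + 2) (Suc d)"
    have e1: "pochhammer (a + g + of_nat (Suc n) + 1) (Suc k) = s * P"
      unfolding s_def P_def pochhammer_rec by (simp add: algebra_simps)
    have e2: "pochhammer (a + 1 + (g + 1) + of_nat n + 1) (Suc k) = P * (s + 1 + of_nat k)"
      unfolding s_def P_def pochhammer_Suc by (simp add: algebra_simps)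
    have e3: "pochhammer (a + 1 + (g + 1) + of_nat n + 1) k = P"
      unfolding s_def P_def by (simp add: algebra_simps)
    have e4: "pochhammer (a + of_nat (Suc k) + 1) (Suc n - Suc k) = R"
      unfolding R_def d by (simp add: algebra_simps)
    have e5: "(a + 2 + of_nat k) * pochhammer (a + 1 + of_nat (Suc k) + 1) (n - Suc k) = R"
      unfolding R_def d pochhammer_rec by (simp add: algebra_simps)
    have e6: "pochhammer (a + 1 + of_nat k + 1) (n - k) = R"
      unfolding R_def d by (simp add: algebra_simps)
    have c: "of_nat (Suc n choose Suc k) = (of_nat (n choose k) + of_nat (n choose Suc k) :: 'a)"
      by simp
    have "Suc k * (n choose Suc k) = (n - k) * (n choose k)"
      by (simp only: binomial_absorb_comp binomial_absorption)
    then have "of_nat (Suc k * (n choose Suc k)) = (of_nat ((n - k) * (n choose k)) :: 'a)"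
      by simp
    then have c2: "(of_nat k + 1) * of_nat (n choose Suc k) = (of_nat n - of_nat k) * (of_nat (n choose k) :: 'a)"
      using 1 by (simp add: of_nat_diff algebra_simps)
    have g: "a + g + 2 + of_nat k = s - (of_nat n - of_nat k)"
      by (simp add: s_def)
    have "jacobi_coeff a g (Suc n) (Suc k) - ((a + 2 + of_nat k) * jacobi_coeff (a + 1) (g + 1) n (Suc k)
     - (a + g + 2 + of_nat k) * jacobi_coeff (a + 1) (g + 1) n k)
      = (-1) ^ Suc k * P * R * (of_nat (Suc n choose Suc k) * s
          - of_nat (n choose Suc k) * (s + 1 + of_nat k)
          - (a + g + 2 + of_nat k) * of_nat (n choose k))"
      unfolding jacobi_coeff_def e1 e2 e3 e4 e6 e5[symmetric]
      using e5 e6 by (simp add: algebra_simps)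
    also have "of_nat (Suc n choose Suc k) * s - of_nat (n choose Suc k) * (s + 1 + of_nat k)
          - (a + g + 2 + of_nat k) * of_nat (n choose k) = 0"
      unfolding c g using c2 by (simp add: algebra_simps)
    finally show ?thesis by simp
  next
    case 2
    then show ?thesis
      by (simp add: jacobi_coeff_def pochhammer_rec binomial_eq_0 algebra_simps)
  next
    case 3
    then show ?thesis by (simp add: jacobi_coeff_eq_0)
  qed
qed

definition jacobi_fps :: "'a \<Rightarrow> 'a \<Rightarrow> nat \<Rightarrow> 'a::field_char_0 fps" where
  "jacobi_fps a g n = Abs_fps (jacobi_coeff a g n)"

text \<open>
  The recursion that \<open>fps_jacobi_op_Suc\<close> forces on the cofactor of \<open>(1 - X) powr g\<close>: differentiating
  \<open>(1 - X) powr (g+1) Q\<close> produces \<open>(1 - X) powr g ((1 - X) Q' - (g+1) Q)\<close>.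
\<close>

lemma jacobi_fps_rec:
  "jacobi_fps a g (Suc n) =
     (fps_const (a + 1) * (1 - fps_X) - fps_const (g + 1) * fps_X) * jacobi_fps (a + 1) (g + 1) n
      + fps_X * (1 - fps_X) * fps_deriv (jacobi_fps (a + 1) (g + 1) n)"
proof (rule fps_ext)
  fix l
  show "jacobi_fps a g (Suc n) $ l =
    ((fps_const (a + 1) * (1 - fps_X) - fps_const (g + 1) * fps_X) * jacobi_fps (a + 1) (g + 1) n
      + fps_X * (1 - fps_X) * fps_deriv (jacobi_fps (a + 1) (g + 1) n)) $ l"
  proof (cases l)
    case 0
    then show ?thesis
      by (simp add: jacobi_fps_def jacobi_coeff_def pochhammer_rec algebra_simps)
  next
    case (Suc k)
    then show ?thesis
      by (cases k) (simp_all add: jacobi_fps_def jacobi_coeff_Suc algebra_simps)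
  qed
qed

lemma fps_jacobi_op_one_minus_powr:
  "fps_jacobi_op a n (fps_one_minus_powr (g + of_nat n)) = fps_one_minus_powr g * jacobi_fps a g n"
proof (induction n arbitrary: a g)
  case 0
  have "jacobi_fps a g 0 = 1"
    by (auto simp add: fps_eq_iff jacobi_fps_def jacobi_coeff_def)
  then show ?case by simp
next
  case (Suc n)
  define Q where "Q = jacobi_fps (a + 1) (g + 1) n"
  have IH: "fps_jacobi_op (a + 1) n (fps_one_minus_powr (g + of_nat (Suc n))) =
      fps_one_minus_powr (g + 1) * Q"
    using Suc.IH[of "a + 1" "g + 1"] by (simp add: Q_def add.assoc)
  have "fps_const (a + 1) * (fps_one_minus_powr (g + 1) * Q) +
         fps_X * fps_deriv (fps_one_minus_powr (g + 1) * Q) =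
        fps_one_minus_powr g * jacobi_fps a g (Suc n)"
    unfolding fps_deriv_mult fps_deriv_one_minus_powr jacobi_fps_rec Q_def[symmetric]
    unfolding fps_one_minus_powr_add_1 fps_const_neg[symmetric]
    by (simp add: algebra_simps del: fps_const_add fps_const_neg)
  then show ?case
    unfolding fps_jacobi_op_Suc IH .
qed

lemma jacobi_fps_eq_sum:
  "jacobi_fps a g n = (\<Sum>k\<in>{0..n}. fps_const (jacobi_coeff a g n k) * fps_X ^ k)"
proof (rule fps_ext)
  fix l
  have "(\<Sum>k\<in>{0..n}. fps_const (jacobi_coeff a g n k) * fps_X ^ k) $ l
      = (\<Sum>k\<in>{0..n}. if l = k then jacobi_coeff a g n k else 0)"
    unfolding fps_sum_nth by (intro sum.cong) auto
  then show "jacobi_fps a g n $ l = (\<Sum>k\<in>{0..n}. fps_const (jacobi_coeff a g n k) * fps_X ^ k) $ l"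
    by (simp add: jacobi_fps_def jacobi_coeff_eq_0)
qed

section \<open>Iterating the operators\<close>

lemma sum_PiE_insert:
  assumes "x \<notin> S"
  shows "(\<Sum>k\<in>Pi\<^sub>E (insert x S) A. f k) = (\<Sum>y\<in>A x. \<Sum>k\<in>Pi\<^sub>E S A. f (k(x := y)))"
proof -
  have "(\<Sum>k\<in>Pi\<^sub>E (insert x S) A. f k) = (\<Sum>(y, k)\<in>A x \<times> Pi\<^sub>E S A. f (k(x := y)))"
    unfolding PiE_insert_eq using inj_combinator[OF assms, of A]
    by (subst sum.reindex) (auto simp: case_prod_unfold)
  then show ?thesis
    by (simp add: sum.cartesian_product)
qed

text \<open>
  The coefficient contributed by the exponents \<open>k j, ..., k m\<close> when the operators with indices
  \<open>j, ..., m\<close> act on \<open>(1 - X) powr (g + n j + ... + n m)\<close>. When operator \<open>i\<close> is applied, the ones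
  with larger index have already produced the monomial of degree \<open>k (i+1) + ... + k m\<close>, which
  shifts \<open>\<alpha> i\<close>. They have also used up the corresponding part of the exponent of \<open>1 - X\<close>, and
  operator \<open>i\<close> itself leaves \<open>g + n j + ... + n (i-1)\<close>.
\<close>

definition jacobi_pineiro_weight ::
  "nat \<Rightarrow> (nat \<Rightarrow> nat) \<Rightarrow> (nat \<Rightarrow> 'a) \<Rightarrow> 'a \<Rightarrow> nat \<Rightarrow> (nat \<Rightarrow> nat) \<Rightarrow> 'a::field_char_0" where
  "jacobi_pineiro_weight m n \<alpha> g j k =
     (\<Prod>i=j..m. jacobi_coeff (\<alpha> i + of_nat (\<Sum>l=i+1..m. k l)) (g + of_nat (\<Sum>l=j..<i. n l)) (n i) (k i))"

lemma jacobi_pineiro_weight_rec: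
  assumes "j \<le> m"
  shows "jacobi_pineiro_weight m n \<alpha> g j (k(j := y)) =
    jacobi_coeff (\<alpha> j + of_nat (\<Sum>l=j+1..m. k l)) g (n j) y *
    jacobi_pineiro_weight m n \<alpha> (g + of_nat (n j)) (Suc j) k"
proof -
  have "(\<Sum>l=i+1..m. (k(j := y)) l) = (\<Sum>l=i+1..m. k l)" if "j \<le> i" for i
    using that by (intro sum.cong) auto
  moreover have "(\<Sum>l=j..<i. n l) = n j + (\<Sum>l=Suc j..<i. n l)" if "Suc j \<le> i" for i
    using that by (simp add: sum.atLeast_Suc_lessThan)
  ultimately show ?thesis
    unfolding jacobi_pineiro_weight_def using assms
    by (subst prod.atLeast_Suc_atMost) (auto intro!: arg_cong2[of _ _ _ _ "(*)"] prod.cong simp: add.assoc)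
qed

text \<open>
  Downward induction on \<open>j\<close>, since the operator with the largest index acts first. Each step applies
  the Rodrigues formula to every term of the sum produced so far.
\<close>

lemma foldr_fps_jacobi_op_one_minus_powr:
  assumes "j \<le> Suc m"
  shows "foldr (\<lambda>j. fps_jacobi_op (\<alpha> j) (n j)) [j..<Suc m]
      (fps_one_minus_powr (g + of_nat (\<Sum>i=j..m. n i))) =
    fps_one_minus_powr g * (\<Sum>k\<in>(\<Pi>\<^sub>E i\<in>{j..m}. {0..n i}).
      fps_const (jacobi_pineiro_weight m n \<alpha> g j k) * fps_X ^ (\<Sum>i=j..m. k i))"
  using assms
proof (induction j arbitrary: g rule: inc_induct)
  case base
  show ?case
    by (simp add: jacobi_pineiro_weight_def)
next
  case (step j)
  define B where "B = fps_one_minus_powr (g + of_nat (n j))"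
  define w where "w = jacobi_pineiro_weight m n \<alpha> (g + of_nat (n j)) (Suc j)"
  define K where "K = (\<lambda>k. \<Sum>i=Suc j..m. k i :: nat)"
  define I where "I = (\<Pi>\<^sub>E i\<in>{Suc j..m}. {0..n i})"
  have j: "j \<le> m" using step.hyps by simp
  have "g + of_nat (\<Sum>i=j..m. n i) = g + of_nat (n j) + of_nat (\<Sum>i=Suc j..m. n i)"
    using j by (simp add: sum.atLeast_Suc_atMost add.assoc)
  then have "foldr (\<lambda>j. fps_jacobi_op (\<alpha> j) (n j)) [j..<Suc m]
      (fps_one_minus_powr (g + of_nat (\<Sum>i=j..m. n i))) =
      fps_jacobi_op (\<alpha> j) (n j) (B * (\<Sum>k\<in>I. fps_const (w k) * fps_X ^ K k))"
    using j step.IH[of "g + of_nat (n j)"]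
    by (simp only: upt_conv_Cons[of j "Suc m"] less_Suc_eq_le foldr.simps comp_apply B_def w_def K_def I_def)
  also have "B * (\<Sum>k\<in>I. fps_const (w k) * fps_X ^ K k) = (\<Sum>k\<in>I. fps_const (w k) * (fps_X ^ K k * B))"
    unfolding sum_distrib_left by (intro sum.cong) (simp_all add: mult_ac)
  also have "fps_jacobi_op (\<alpha> j) (n j) \<dots> = (\<Sum>k\<in>I. fps_const (w k) * (fps_X ^ K k *
      (fps_one_minus_powr g * jacobi_fps (\<alpha> j + of_nat (K k)) g (n j))))"
    by (simp only: fps_jacobi_op_sum fps_jacobi_op_const_mult fps_jacobi_op_X_power B_def
      fps_jacobi_op_one_minus_powr)
  also have "\<dots> = fps_one_minus_powr g * (\<Sum>k\<in>I. fps_const (w k) * fps_X ^ K k * jacobi_fps (\<alpha> j + of_nat (K k)) g (n j))"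
    unfolding sum_distrib_left by (intro sum.cong) (simp_all only: mult_ac)
  also have "(\<Sum>k\<in>I. fps_const (w k) * fps_X ^ K k * jacobi_fps (\<alpha> j + of_nat (K k)) g (n j)) =
     (\<Sum>k\<in>I. \<Sum>y\<in>{0..n j}. fps_const (jacobi_pineiro_weight m n \<alpha> g j (k(j := y))) * fps_X ^ (y + K k))"
    unfolding jacobi_fps_eq_sum jacobi_pineiro_weight_rec[OF j] sum_distrib_left
    by (intro sum.cong refl) (simp only: w_def K_def power_add mult_ac Suc_eq_plus1 flip: fps_const_mult)
  also have "\<dots> = (\<Sum>y\<in>{0..n j}. \<Sum>k\<in>I. fps_const (jacobi_pineiro_weight m n \<alpha> g j (k(j := y))) *
         fps_X ^ (\<Sum>i=j..m. (k(j := y)) i))"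
    using j by (subst sum.swap) (simp add: sum.atLeast_Suc_atMost K_def)
  also have "\<dots> = (\<Sum>k\<in>Pi\<^sub>E (insert j {Suc j..m}) (\<lambda>i. {0..n i}).
      fps_const (jacobi_pineiro_weight m n \<alpha> g j k) * fps_X ^ (\<Sum>i=j..m. k i))"
    unfolding I_def by (subst sum_PiE_insert) simp_all
  also have "insert j {Suc j..m} = {j..m}"
    using j by auto
  finally show ?case .
qed

section \<open>From real derivatives to formal power series\<close>

lemma fps_conv_radius_one_minus_powr:
  "fps_conv_radius (fps_one_minus_powr (c :: complex)) \<ge> 1"
proof -
  have "norm (fps_one_minus_powr c $ l) = norm (fps_binomial c $ l)" for l
    by (simp add: gbinomial_pochhammer norm_mult norm_divide norm_power)
  then have "fps_conv_radius (fps_one_minus_powr c) = fps_conv_radius (fps_binomial c)"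
    unfolding fps_conv_radius_def
    by (subst (1 2) conv_radius_norm[symmetric]) (simp only:)
  then show ?thesis
    by (simp add: fps_conv_radius_binomial)
qed

lemma eval_fps_one_minus_powr:
  assumes "norm (z :: complex) < 1"
  shows "eval_fps (fps_one_minus_powr c) z = (1 - z) powr c"
proof -
  have "(\<lambda>l. (c gchoose l) * (- z) ^ l) sums (1 + - z) powr c"
    using assms by (intro gen_binomial_complex) simp
  moreover have "(c gchoose l) * (- z) ^ l = fps_one_minus_powr c $ l * z ^ l" for l
    by (simp add: gbinomial_pochhammer power_minus[of z])
  ultimately show ?thesis
    by (simp add: eval_fps_def sums_iff)
qed

lemma fps_conv_radius_jacobi_op:
  fixes F :: "complex fps"
  shows "fps_conv_radius F \<le> fps_conv_radius (fps_jacobi_op a n F)"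
proof (induction n arbitrary: a)
  case (Suc n)
  define G where "G = fps_jacobi_op (a + 1) n F"
  have G: "fps_conv_radius F \<le> fps_conv_radius G"
    unfolding G_def by (rule Suc.IH)
  have "fps_conv_radius F \<le> min (fps_conv_radius (fps_const (a + 1) * G)) (fps_conv_radius (fps_X * fps_deriv G))"
    using G fps_conv_radius_mult[of "fps_const (a + 1)" G] fps_conv_radius_deriv[of G]
      fps_conv_radius_mult[of fps_X "fps_deriv G"]
    by (auto simp: min_def split: if_splits intro: order_trans)
  also have "\<dots> \<le> fps_conv_radius (fps_jacobi_op a (Suc n) F)"
    unfolding fps_jacobi_op_Suc G_def[symmetric] by (rule fps_conv_radius_add)
  finally show ?case .
qed simp

text \<open>
  Induction on \<open>n\<close>, with \<open>a + 1\<close> in place of \<open>a\<close> for the first \<open>n\<close> derivatives. The function \<open>f\<close>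
  is prescribed on \<open>(0,1)\<close> only, because that is all that is known about the result of the previous
  operator; the derivatives there do not see any other values.
\<close>

lemma funpow_vector_derivative_powr_eval_fps:
  fixes F :: "complex fps"
  assumes "1 \<le> fps_conv_radius F"
    and "\<And>x. x \<in> {0<..<1} \<Longrightarrow> f x = of_real x powr (of_nat n + a) * eval_fps F (of_real x)"
    and "x \<in> {0<..<1}"
  shows "((\<lambda>g x. vector_derivative g (at x)) ^^ n) f x =
    of_real x powr a * eval_fps (fps_jacobi_op a n F) (of_real x)"
  using assms(2,3)
proof (induction n arbitrary: a x)
  case 0
  then show ?case by simp
next
  case (Suc n)
  define G where "G = fps_jacobi_op (a + 1) n F"
  define h where "h = ((\<lambda>g x. vector_derivative g (at x)) ^^ n) f"
  define z where "z = complex_of_real x"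
  have h: "h y = of_real y powr (a + 1) * eval_fps G (of_real y)" if "y \<in> {0<..<1}" for y
    unfolding h_def G_def using Suc.prems(1) that by (intro Suc.IH) (simp_all add: add_ac)
  have z: "z \<noteq> 0" "z \<notin> \<real>\<^sub>\<le>\<^sub>0"
    using Suc.prems(2) by (auto simp: z_def)
  have "ereal (norm z) < 1"
    using Suc.prems(2) by (simp add: z_def)
  also have "1 \<le> fps_conv_radius G"
    unfolding G_def using assms(1) fps_conv_radius_jacobi_op order_trans by blast
  finally have r: "ereal (norm z) < fps_conv_radius G" .
  then have r': "ereal (norm z) < fps_conv_radius (fps_deriv G)"
    using fps_conv_radius_deriv order_less_le_trans by blast
  have "((\<lambda>w. w powr (a + 1) * eval_fps G w) has_field_derivative
      z powr (a + 1) * eval_fps (fps_deriv G) z + (a + 1) * z powr (a + 1 - 1) * eval_fps G z) (at z)"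
    by (intro DERIV_mult' has_field_derivative_powr has_field_derivative_eval_fps z r)
  also have "z powr (a + 1) * eval_fps (fps_deriv G) z + (a + 1) * z powr (a + 1 - 1) * eval_fps G z
      = z powr a * eval_fps (fps_jacobi_op a (Suc n) F) z"
  proof -
    have "eval_fps (fps_jacobi_op a (Suc n) F) z = (a + 1) * eval_fps G z + z * eval_fps (fps_deriv G) z"
      unfolding fps_jacobi_op_Suc G_def[symmetric] using r r'
      by (subst eval_fps_add)
        (auto simp: eval_fps_mult fps_conv_radius_cmult_left intro!: order_less_le_trans[OF _ fps_conv_radius_mult] split: if_splits)
    then show ?thesis
      using z by (simp add: powr_add algebra_simps)
  qed
  finally have "((\<lambda>y. of_real y powr (a + 1) * eval_fps G (of_real y)) has_vector_derivative
      z powr a * eval_fps (fps_jacobi_op a (Suc n) F) z) (at x)"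
    unfolding z_def by (rule has_vector_derivative_real_field)
  then have "(h has_vector_derivative z powr a * eval_fps (fps_jacobi_op a (Suc n) F) z) (at x)"
    by (rule has_vector_derivative_transform_within_open[of _ _ _ "{0<..<1}"]) (use h Suc.prems(2) in auto)
  then show ?case
    by (simp add: h_def z_def vector_derivative_at)
qed

lemma rodrigues_op_eval_fps:
  assumes "1 \<le> fps_conv_radius F" and "\<And>x. x \<in> {0<..<1} \<Longrightarrow> f x = eval_fps F (of_real x)"
    and "x \<in> {0<..<1}"
  shows "rodrigues_op a n f x = eval_fps (fps_jacobi_op a n F) (of_real x)"
proof -
  have "((\<lambda>g x. vector_derivative g (at x)) ^^ n) (\<lambda>x. of_real x powr (of_nat n + a) * f x) x =
      of_real x powr a * eval_fps (fps_jacobi_op a n F) (of_real x)"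
    by (rule funpow_vector_derivative_powr_eval_fps) (use assms in simp_all)
  moreover have "complex_of_real x powr (- a) * of_real x powr a = 1"
    using assms(3) by (simp flip: powr_add)
  ultimately show ?thesis
    by (simp add: rodrigues_op_def flip: mult.assoc)
qed

lemma foldr_rodrigues_op_eval_fps:
  fixes f :: "real \<Rightarrow> complex"
  assumes "1 \<le> fps_conv_radius F" and "\<And>x. x \<in> {0<..<1} \<Longrightarrow> f x = eval_fps F (of_real x)"
  shows "1 \<le> fps_conv_radius (foldr (\<lambda>j. fps_jacobi_op (\<alpha> j) (n j)) js F)"
    and "x \<in> {0<..<1} \<Longrightarrow> foldr (\<lambda>j. rodrigues_op (\<alpha> j) (n j)) js f x =
      eval_fps (foldr (\<lambda>j. fps_jacobi_op (\<alpha> j) (n j)) js F) (of_real x)"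
proof (induction js arbitrary: x)
  case (Cons j js)
  { case 1 show ?case
      using Cons.IH(1) fps_conv_radius_jacobi_op order_trans by (simp) blast }
  { case 2 then show ?case
      using rodrigues_op_eval_fps[OF Cons.IH] by simp }
qed (use assms in simp_all)

section \<open>Comparison with the hypergeometric coefficients\<close>

lemma pochhammer_add_of_nat_nonzero:
  fixes a :: complex
  assumes "a \<notin> {- of_nat l |l. l \<ge> 1}"
  shows "pochhammer (a + of_nat N + 1) K \<noteq> 0"
proof
  assume "pochhammer (a + of_nat N + 1) K = 0"
  then obtain k where "a + of_nat N + 1 = - of_nat k"
    unfolding pochhammer_eq_0_iff by blast
  then have "a = - of_nat (k + N + 1)"
    by (simp add: algebra_simps eq_neg_iff_add_eq_0)
  with assms show False
    by (metis (mono_tags, lifting) le_add2 mem_Collect_eq)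
qed

text \<open>
  Every Pochhammer symbol whose base is shifted by \<open>K\<close> is a quotient of two with fixed base, by
  \<open>(x)_(K+k) = (x)_K (x+K)_k\<close>. The remaining one is treated by computing \<open>(a+1)_(n+K)\<close> in two
  ways. The result separates into factors that depend on \<open>K\<close> or on \<open>k + K\<close> only, which is what
  allows the factors of neighbouring indices to be regrouped.
\<close>

lemma jacobi_coeff_conv_pochhammer:
  fixes a g :: "'a :: field_char_0"
  assumes "k \<le> n" and "pochhammer (a + 1) (k + K) \<noteq> 0" and "pochhammer (a + g + of_nat n + 1) K \<noteq> 0"
  shows "jacobi_coeff (a + of_nat K) g n k =
    pochhammer (a + 1) n * (pochhammer (- of_nat n) k / fact k) *
    (pochhammer (a + of_nat n + 1) K / pochhammer (a + g + of_nat n + 1) K) *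
    (pochhammer (a + g + of_nat n + 1) (k + K) / pochhammer (a + 1) (k + K))"
proof -
  have e1: "(- 1) ^ k * of_nat (n choose k) = (pochhammer (- of_nat n) k / fact k :: 'a)"
    by (simp add: binomial_gbinomial gbinomial_pochhammer)
  have e2: "pochhammer (a + g + of_nat n + 1) (k + K) =
      pochhammer (a + g + of_nat n + 1) K * pochhammer (a + of_nat K + g + of_nat n + 1) k"
    by (subst add.commute, subst pochhammer_product') (simp add: add_ac)
  have "pochhammer (a + 1) (k + K) * pochhammer (a + of_nat K + of_nat k + 1) (n - k) = pochhammer (a + 1) (n + K)"
    using assms(1) pochhammer_product'[of "a + 1" "k + K" "n - k"] by (simp add: add_ac)
  also have "\<dots> = pochhammer (a + 1) n * pochhammer (a + of_nat n + 1) K"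
    by (subst pochhammer_product') (simp add: add_ac)
  finally have e3: "pochhammer (a + of_nat K + of_nat k + 1) (n - k) =
      pochhammer (a + 1) n * pochhammer (a + of_nat n + 1) K / pochhammer (a + 1) (k + K)"
    using assms(2) by (simp add: field_simps)
  show ?thesis
    unfolding jacobi_coeff_def e1 e2 e3 using assms(3) by simp
qed

text \<open>
  With \<open>K i = k (i+1) + ... + k m\<close> the second factor is evaluated at \<open>k i + K i = K (i-1)\<close>. Shifting
  its index by one pairs it with the first factor at the same \<open>K\<close>, leaving \<open>K 0\<close> by itself;
  the unpaired first factor has argument \<open>K m = 0\<close>.
\<close>

lemma prod_shift_partial_sums:
  fixes f g :: "nat \<Rightarrow> nat \<Rightarrow> 'a :: comm_monoid_mult" and k :: "nat \<Rightarrow> nat"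
  assumes "m \<ge> 1" and "f m 0 = 1"
  shows "(\<Prod>i=1..m. f i (\<Sum>j=i+1..m. k j) * g i (k i + (\<Sum>j=i+1..m. k j))) =
    g 1 (\<Sum>j=1..m. k j) * (\<Prod>i=1..<m. f i (\<Sum>j=i+1..m. k j) * g (i+1) (\<Sum>j=i+1..m. k j))"
proof -
  define K where "K = (\<lambda>i. \<Sum>j=i+1..m. k j)"
  have "{1..m} = insert m {1..<m}"
    using assms(1) by auto
  then have f: "(\<Prod>i=1..m. f i (K i)) = (\<Prod>i=1..<m. f i (K i))"
    using assms(2) by (simp add: K_def)
  have "(\<Prod>i=1..m. g i (k i + K i)) = (\<Prod>i=1..m. g i (K (i - 1)))"
    by (intro prod.cong) (auto simp: K_def sum.atLeast_Suc_atMost)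
  also have "\<dots> = g 1 (K 0) * (\<Prod>i=Suc 1..m. g i (K (i - 1)))"
    using assms(1) by (subst prod.atLeast_Suc_atMost) auto
  also have "(\<Prod>i=Suc 1..m. g i (K (i - 1))) = (\<Prod>i=1..<m. g (i+1) (K i))"
    by (rule prod.reindex_bij_witness[of _ Suc "\<lambda>i. i - 1"]) auto
  finally show ?thesis
    using f by (simp add: prod.distrib K_def mult_ac)
qed

lemma jacobi_pineiro_weight_conv_pochhammer:
  fixes \<alpha> :: "nat \<Rightarrow> complex"
  assumes "m \<ge> 1"
    and "\<And>j. j \<in> {1..m} \<Longrightarrow> \<alpha> j \<notin> {- of_nat l |l. l \<ge> 1}"
    and "\<And>j. j \<in> {1..m} \<Longrightarrow> \<alpha> j + \<beta> \<notin> {- of_nat l |l. l \<ge> 1}"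
    and "\<And>j. s j = (\<Sum>i=1..j. n i)"
    and "k \<in> (\<Pi>\<^sub>E j\<in>{1..m}. {0..n j})"
  shows "jacobi_pineiro_weight m n \<alpha> \<beta> 1 k =
    (\<Prod>j=1..m. pochhammer (\<alpha> j + 1) (n j)) *
    (pochhammer (\<alpha> 1 + \<beta> + of_nat (n 1) + 1) (multi_size m k) /
          pochhammer (\<alpha> 1 + 1) (multi_size m k) *
        (\<Prod>i=1..<m.
          let K = (\<Sum>j=i+1..m. k j) in
          (pochhammer (\<alpha> i + of_nat (n i) + 1) K *
             pochhammer (\<alpha> (i+1) + of_nat (s (i+1)) + \<beta> + 1) K) /
          (pochhammer (\<alpha> (i+1) + 1) K *
             pochhammer (\<alpha> i + of_nat (s i) + \<beta> + 1) K)) *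
      (\<Prod>j=1..m. pochhammer (- of_nat (n j)) (k j) / fact (k j)))"
proof -
  \<comment> \<open>In the factor of index \<open>i\<close>, \<open>f i\<close> collects what depends on \<open>k (i+1) + ... + k m\<close>,
    and \<open>g i\<close> what depends on \<open>k i + ... + k m\<close>.\<close>
  define f where "f = (\<lambda>i K. pochhammer (\<alpha> i + of_nat (n i) + 1) K / pochhammer (\<alpha> i + of_nat (s i) + \<beta> + 1) K)"
  define g where "g = (\<lambda>i K. pochhammer (\<alpha> i + of_nat (s i) + \<beta> + 1) K / pochhammer (\<alpha> i + 1) K)"
  have factor: "jacobi_coeff (\<alpha> i + of_nat (\<Sum>l=i+1..m. k l)) (\<beta> + of_nat (\<Sum>l=1..<i. n l)) (n i) (k i) =
     pochhammer (\<alpha> i + 1) (n i) * (pochhammer (- of_nat (n i)) (k i) / fact (k i)) *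
     (f i (\<Sum>j=i+1..m. k j) * g i (k i + (\<Sum>j=i+1..m. k j)))" if i: "i \<in> {1..m}" for i
  proof -
    have "{1..i} = insert i {1..<i}"
      using i by auto
    then have "s i = (\<Sum>l=1..<i. n l) + n i"
      by (simp add: assms(4))
    then have s: "\<alpha> i + (\<beta> + of_nat (\<Sum>l=1..<i. n l)) + of_nat (n i) + 1 = \<alpha> i + of_nat (s i) + \<beta> + 1"
      by (simp add: add_ac)
    have "pochhammer (\<alpha> i + of_nat (s i) + \<beta> + 1) K \<noteq> 0" for K
      using pochhammer_add_of_nat_nonzero[OF assms(3)[OF i], of "s i" K] by (simp add: add_ac)
    moreover have "pochhammer (\<alpha> i + 1) K \<noteq> 0" for K
      using pochhammer_add_of_nat_nonzero[OF assms(2)[OF i], of 0 K] by simp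
    moreover have "k i \<le> n i"
      using assms(5) i by (auto simp: PiE_iff)
    ultimately show ?thesis
      by (subst jacobi_coeff_conv_pochhammer) (simp_all only: s f_def g_def mult.assoc not_False_eq_True)
  qed
  have "jacobi_pineiro_weight m n \<alpha> \<beta> 1 k = (\<Prod>j=1..m. pochhammer (\<alpha> j + 1) (n j)) *
      (\<Prod>j=1..m. pochhammer (- of_nat (n j)) (k j) / fact (k j)) *
      (\<Prod>i=1..m. f i (\<Sum>j=i+1..m. k j) * g i (k i + (\<Sum>j=i+1..m. k j)))"
    unfolding jacobi_pineiro_weight_def prod.distrib[symmetric] by (intro prod.cong refl factor)
  also have "(\<Prod>i=1..m. f i (\<Sum>j=i+1..m. k j) * g i (k i + (\<Sum>j=i+1..m. k j))) =
     g 1 (\<Sum>j=1..m. k j) * (\<Prod>i=1..<m. f i (\<Sum>j=i+1..m. k j) * g (i+1) (\<Sum>j=i+1..m. k j))"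
    by (rule prod_shift_partial_sums) (use assms(1) in \<open>simp_all add: f_def\<close>)
  also have "g 1 (\<Sum>j=1..m. k j) = pochhammer (\<alpha> 1 + \<beta> + of_nat (n 1) + 1) (multi_size m k) /
          pochhammer (\<alpha> 1 + 1) (multi_size m k)"
    by (simp add: g_def multi_size_def assms(4) add_ac)
  also have "(\<Prod>i=1..<m. f i (\<Sum>j=i+1..m. k j) * g (i+1) (\<Sum>j=i+1..m. k j)) = (\<Prod>i=1..<m.
          let K = (\<Sum>j=i+1..m. k j) in
          (pochhammer (\<alpha> i + of_nat (n i) + 1) K *
             pochhammer (\<alpha> (i+1) + of_nat (s (i+1)) + \<beta> + 1) K) /
          (pochhammer (\<alpha> (i+1) + 1) K *
             pochhammer (\<alpha> i + of_nat (s i) + \<beta> + 1) K))"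
    by (simp only: f_def g_def Let_def times_divide_times_eq mult.commute)
  finally show ?thesis
    by (simp only: mult_ac)
qed

lemma foldr_fps_jacobi_op_nth:
  "foldr (\<lambda>j. fps_jacobi_op (\<alpha> j) (n j)) js F $ l =
     prod_list (map (\<lambda>j. pochhammer (\<alpha> j + 1 + of_nat l) (n j)) js) * F $ l"
  by (induction js) (simp_all add: mult.assoc)

lemma foldl_mult_conv_prod_list:
  fixes f :: "'b \<Rightarrow> 'a :: comm_monoid_mult"
  shows "foldl (\<lambda>r a. r * f a) c xs = c * prod_list (map f xs)"
  by (induction xs arbitrary: c) (simp_all add: mult.assoc)

lemma prod_list_map_upt: "prod_list (map f [a..<Suc m]) = (\<Prod>j=a..m. f j)"
proof -
  have "set [a..<Suc m] = {a..m}" by auto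
  then show ?thesis
    using prod.distinct_set_conv_list[of "[a..<Suc m]" f] by simp
qed

text \<open>
  The symbol \<open>(a+1)_(l+n)\<close>, split after \<open>l\<close> or after \<open>n\<close> factors, gives
  \<open>(a+1+l)_n = (a+1)_n (a+n+1)_l / (a+1)_l\<close>; the product over \<open>j\<close> is the ratio of Pochhammer
  symbols in the hypergeometric coefficient, and the binomial series supplies \<open>(-c)_l / l!\<close>.
\<close>

lemma foldr_fps_jacobi_op_eq_hypergeo:
  fixes \<alpha> :: "nat \<Rightarrow> complex"
  assumes "\<And>j. j \<in> {1..m} \<Longrightarrow> \<alpha> j \<notin> {- of_nat l |l. l \<ge> 1}"
  shows "foldr (\<lambda>j. fps_jacobi_op (\<alpha> j) (n j)) [1..<Suc m] (fps_one_minus_powr c) =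
    fps_const (\<Prod>j=1..m. pochhammer (\<alpha> j + 1) (n j)) *
    fps_hypergeo (map (\<lambda>j. \<alpha> j + of_nat (n j) + 1) [1..<Suc m] @ [- c])
      (map (\<lambda>j. \<alpha> j + 1) [1..<Suc m]) 1"
proof (rule fps_ext)
  fix l
  have factor: "pochhammer (\<alpha> j + 1 + of_nat l) (n j) =
     pochhammer (\<alpha> j + 1) (n j) * pochhammer (\<alpha> j + of_nat (n j) + 1) l / pochhammer (\<alpha> j + 1) l"
    if "j \<in> {1..m}" for j
  proof -
    have "pochhammer (\<alpha> j + 1) l \<noteq> 0"
      using pochhammer_add_of_nat_nonzero[OF assms[OF that], of 0] by simp
    moreover have "pochhammer (\<alpha> j + 1) l * pochhammer (\<alpha> j + 1 + of_nat l) (n j) =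
        pochhammer (\<alpha> j + 1) (n j) * pochhammer (\<alpha> j + 1 + of_nat (n j)) l"
      using pochhammer_product'[of "\<alpha> j + 1" l "n j"] pochhammer_product'[of "\<alpha> j + 1" "n j" l]
      by (simp only: add.commute[of l "n j"])
    ultimately show ?thesis
      by (simp add: field_simps add_ac)
  qed
  have "(\<Prod>j=1..m. pochhammer (\<alpha> j + 1 + of_nat l) (n j)) =
     (\<Prod>j=1..m. pochhammer (\<alpha> j + 1) (n j)) * (\<Prod>j=1..m. pochhammer (\<alpha> j + of_nat (n j) + 1) l) /
      (\<Prod>j=1..m. pochhammer (\<alpha> j + 1) l)"
    by (simp only: prod.distrib[symmetric] prod_dividef[symmetric] factor cong: prod.cong)
  then show "foldr (\<lambda>j. fps_jacobi_op (\<alpha> j) (n j)) [1..<Suc m] (fps_one_minus_powr c) $ l =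
    (fps_const (\<Prod>j=1..m. pochhammer (\<alpha> j + 1) (n j)) *
    fps_hypergeo (map (\<lambda>j. \<alpha> j + of_nat (n j) + 1) [1..<Suc m] @ [- c])
      (map (\<lambda>j. \<alpha> j + 1) [1..<Suc m]) 1) $ l"
    by (simp add: foldr_fps_jacobi_op_nth foldl_mult_conv_prod_list prod_list_map_upt comp_def del: upt_Suc)
qed

section \<open>The two representations\<close>

lemma poly_eqI_unit_interval:
  fixes p q :: "complex poly"
  assumes "\<And>t. t \<in> {0<..<1::real} \<Longrightarrow> poly p (of_real t) = poly q (of_real t)"
  shows "p = q"
proof (rule ccontr)
  assume "p \<noteq> q"
  then have "finite {z. poly (p - q) z = 0}"
    by (intro poly_roots_finite) simp
  moreover have "complex_of_real ` {0<..<1} \<subseteq> {z. poly (p - q) z = 0}"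
    using assms by auto
  ultimately have "finite (complex_of_real ` {0<..<1})"
    by (rule finite_subset[rotated])
  then show False
    by (simp add: finite_image_iff inj_on_def infinite_Ioo[of 0 "1 :: real"])
qed

theorem theorem3p2:
  fixes m :: nat and n :: "nat \<Rightarrow> nat" and \<alpha> :: "nat \<Rightarrow> complex" and \<beta> :: complex
    and s :: "nat \<Rightarrow> nat"
  assumes "m \<ge> 1"
    and "\<And>j. j \<in> {1..m} \<Longrightarrow> \<alpha> j \<notin> {- of_nat l |l. l \<ge> 1}"
    and "\<beta> \<notin> {- of_nat l |l. l \<ge> 1}"
    and "\<And>j. j \<in> {1..m} \<Longrightarrow> \<alpha> j + \<beta> \<notin> {- of_nat l |l. l \<ge> 1}"
    and "\<And>j. s j = (\<Sum>i=1..j. n i)"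
  shows "(\<forall>t. poly (jacobi_pineiro m n \<alpha> \<beta>) t =
      (\<Prod>j=1..m. pochhammer (\<alpha> j + 1) (n j)) / of_nat (multi_fact m n) *
      (\<Sum>k \<in> (\<Pi>\<^sub>E j\<in>{1..m}. {0..n j}).
        pochhammer (\<alpha> 1 + \<beta> + of_nat (n 1) + 1) (multi_size m k) /
          pochhammer (\<alpha> 1 + 1) (multi_size m k) *
        (\<Prod>i=1..<m.
          let K = (\<Sum>j=i+1..m. k j) in
          (pochhammer (\<alpha> i + of_nat (n i) + 1) K *
             pochhammer (\<alpha> (i+1) + of_nat (s (i+1)) + \<beta> + 1) K) /
          (pochhammer (\<alpha> (i+1) + 1) K *
             pochhammer (\<alpha> i + of_nat (s i) + \<beta> + 1) K)) *
        (\<Prod>j=1..m. pochhammer (- of_nat (n j)) (k j) * t ^ k j / fact (k j))))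
    \<and> (\<forall>t. norm t < 1 \<longrightarrow> poly (jacobi_pineiro m n \<alpha> \<beta>) t =
      (\<Prod>j=1..m. pochhammer (\<alpha> j + 1) (n j)) / of_nat (multi_fact m n) *
      (1 - t) powr (- \<beta>) *
      hypergeometric
        (map (\<lambda>j. \<alpha> j + of_nat (n j) + 1) [1..<Suc m] @ [- \<beta> - of_nat (multi_size m n)])
        (map (\<lambda>j. \<alpha> j + 1) [1..<Suc m]) t)"
proof -
  define I where "I = (\<Pi>\<^sub>E j\<in>{1..m}. {0..n j})"
  define N :: complex where "N = of_nat (multi_fact m n)"
  define C where "C = (\<Prod>j=1..m. pochhammer (\<alpha> j + 1) (n j))"
  define w where "w = jacobi_pineiro_weight m n \<alpha> \<beta> 1"
  define p where "p = (\<Sum>k\<in>I. monom (w k) (multi_size m k))"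
  define F0 where "F0 = fps_one_minus_powr (\<beta> + of_nat (multi_size m n))"
  define F where "F = foldr (\<lambda>j. fps_jacobi_op (\<alpha> j) (n j)) [1..<Suc m] F0"
  define H where "H = fps_hypergeo
        (map (\<lambda>j. \<alpha> j + of_nat (n j) + 1) [1..<Suc m] @ [- \<beta> - of_nat (multi_size m n)])
        (map (\<lambda>j. \<alpha> j + 1) [1..<Suc m]) 1"
  have F0: "(1 - of_real x) powr (of_nat (multi_size m n) + \<beta>) = eval_fps F0 (of_real x)"
    if "x \<in> {0<..<1}" for x
    using that by (simp add: F0_def eval_fps_one_minus_powr add.commute)
  have radius_F0: "1 \<le> fps_conv_radius F0"
    unfolding F0_def by (rule fps_conv_radius_one_minus_powr)
  have radius_F: "1 \<le> fps_conv_radius F"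
    unfolding F_def using radius_F0 F0 by (rule foldr_rodrigues_op_eval_fps)
  have "fps_of_poly p = (\<Sum>k\<in>I. fps_const (w k) * fps_X ^ multi_size m k)"
    by (simp add: p_def fps_of_poly_sum fps_of_poly_monom)
  then have F_eq: "F = fps_one_minus_powr \<beta> * fps_of_poly p"
    using foldr_fps_jacobi_op_one_minus_powr[of 1 m \<alpha> n \<beta>]
    by (simp only: F_def F0_def multi_size_def I_def w_def)
  have eval_F: "(1 - z) powr (- \<beta>) * eval_fps F z = poly p z" if "norm z < 1" for z
  proof -
    have "ereal (norm z) < fps_conv_radius (fps_one_minus_powr \<beta>)"
      using that fps_conv_radius_one_minus_powr[of \<beta>] order_less_le_trans[of "ereal (norm z)" 1] by simp
    then have "eval_fps F z = (1 - z) powr \<beta> * poly p z"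
      unfolding F_eq using that by (simp add: eval_fps_mult eval_fps_one_minus_powr)
    moreover have "z \<noteq> 1"
      using that by auto
    then have "(1 - z) powr (- \<beta>) * (1 - z) powr \<beta> = 1"
      by (simp flip: powr_add)
    ultimately show ?thesis
      by (simp flip: mult.assoc)
  qed
  have rodrigues: "rodrigues m n \<alpha> \<beta> t = poly (smult (1 / N) p) (of_real t)" if t: "t \<in> {0<..<1}" for t
  proof -
    have "foldr (\<lambda>j. rodrigues_op (\<alpha> j) (n j)) [1..<Suc m]
       (\<lambda>x. (1 - of_real x) powr (of_nat (multi_size m n) + \<beta>)) t = eval_fps F (of_real t)"
      unfolding F_def using radius_F0 F0 t by (rule foldr_rodrigues_op_eval_fps)
    then show ?thesis
      using eval_F[of "of_real t"] t by (simp add: rodrigues_def N_def mult.assoc del: upt_Suc)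
  qed
  have jp: "jacobi_pineiro m n \<alpha> \<beta> = smult (1 / N) p"
    unfolding jacobi_pineiro_def
    by (rule the_equality) (use rodrigues in \<open>auto intro: poly_eqI_unit_interval\<close>)
  have weight: "w k * t ^ multi_size m k = C * (pochhammer (\<alpha> 1 + \<beta> + of_nat (n 1) + 1) (multi_size m k) /
          pochhammer (\<alpha> 1 + 1) (multi_size m k) *
        (\<Prod>i=1..<m.
          let K = (\<Sum>j=i+1..m. k j) in
          (pochhammer (\<alpha> i + of_nat (n i) + 1) K *
             pochhammer (\<alpha> (i+1) + of_nat (s (i+1)) + \<beta> + 1) K) /
          (pochhammer (\<alpha> (i+1) + 1) K *
             pochhammer (\<alpha> i + of_nat (s i) + \<beta> + 1) K)) *
        (\<Prod>j=1..m. pochhammer (- of_nat (n j)) (k j) * t ^ k j / fact (k j)))" (is "_ = C * (?A * ?B * ?D)")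
    if k: "k \<in> I" for k and t :: complex
  proof -
    have "?D = (\<Prod>j=1..m. pochhammer (- of_nat (n j)) (k j) / fact (k j)) * t ^ multi_size m k"
      by (simp add: multi_size_def power_sum flip: prod.distrib)
    then show ?thesis
      using jacobi_pineiro_weight_conv_pochhammer[OF assms(1,2,4,5) k[unfolded I_def]]
      by (simp only: w_def C_def mult.assoc)
  qed
  have hyp: "C * eval_fps H z = eval_fps F z" if "norm z < 1" for z
  proof -
    have "C \<noteq> 0"
      using pochhammer_add_of_nat_nonzero[OF assms(2), of _ 0] by (auto simp: C_def)
    have "F = fps_const C * H"
      using foldr_fps_jacobi_op_eq_hypergeo[OF assms(2), where n = n and c = "\<beta> + of_nat (multi_size m n)"]
      by (simp add: F_def F0_def C_def H_def del: upt_Suc)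
    then have "H = fps_const (1 / C) * F"
      using \<open>C \<noteq> 0\<close> by (simp flip: mult.assoc)
    moreover have "ereal (norm z) < fps_conv_radius F"
      using that radius_F order_less_le_trans[of "ereal (norm z)" 1] by simp
    ultimately have "eval_fps H z = 1 / C * eval_fps F z"
      by (simp add: eval_fps_mult)
    then show ?thesis
      using \<open>C \<noteq> 0\<close> by simp
  qed
  show ?thesis
  proof (intro conjI allI impI, goal_cases)
    case (1 t)
    have "poly (jacobi_pineiro m n \<alpha> \<beta>) t = 1 / N * (\<Sum>k\<in>I. w k * t ^ multi_size m k)"
      by (simp add: jp p_def poly_sum poly_monom)
    then show ?case
      by (simp only: weight sum_distrib_left[symmetric] C_def N_def I_def cong: sum.cong) simp
  next
    case (2 t)
    then have "poly (jacobi_pineiro m n \<alpha> \<beta>) t = 1 / N * ((1 - t) powr (- \<beta>) * (C * eval_fps H t))"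
      by (simp add: jp eval_F hyp)
    then show ?case
      by (simp add: N_def C_def H_def hypergeometric_def mult_ac del: upt_Suc)
  qed
qed

end
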